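(* Let $\mathcal{A}=(Q,P,M,R)$ be an ACS with $Q=\{q_1,\dots,q_x\}$, $P=\{p_1,\dots,p_y\}$, $M=\{m_1,\dots,m_z\}$, and let $c_{\mathcal{A}_0}$ be a place of $\mathcal{A}$. Suppose $c_{\mathcal{A}}=(u_{\mathcal{A}},v_{\mathcal{A}})$ is a place with $c_{\mathcal{A}_0}\Rightarrow^{*}c_{\mathcal{A}}$, $u_{\mathcal{A}}[q_i]=k_i$ for $1\le i\le x$, and $v_{\mathcal{A}}[(p_i,m_j)]=h_{ij}$ for all $1\le i\le y$, $1\le j\le z$. Then there exists a place $c_{\mathcal{B}}=(u_{\mathcal{B}},v_{\mathcal{B}})$ of the BPP $\mathcal{B}$ associated to $\mathcal{A}$ such that $u_{\mathcal{B}}[q_i]=k_i$ for all $i$, $v_{\mathcal{B}}[(p_i,m_j^{in})]=r_{ij}$ and $v_{\mathcal{B}}[(p_i,m_j^{out})]=s_{ij}$ with $r_{ij}-s_{ij}=h_{ij}$ for all $i,j$, and $c_{\mathcal{B}_0}\to^{\star}c_{\mathcal{B}}$ in $\mathcal{B}$, where $c_{\mathcal{B}_0}$ is the image of $c_{\mathcal{A}_0}$ under the place convert function.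
   Context: An Actor Communicating System (ACS) is a tuple $(Q,P,M,R)$ with $Q$ a finite set of control states, $P$ a finite set of processes, $M$ a finite set of messages, and $R$ a finite set of rules $q_1\xrightarrow{op}q_2$ with $q_1,q_2\in Q$ and $op\in\{nop,\ \nu q_3\ (q_3\in Q),\ p!m,\ p?m\ (p\in P,m\in M)\}$. A place of $\mathcal{A}$ is a pair $(u,v)$ with $u\in\mathbb{N}^{Q}$ (number of processes in each control state) and $v\in\mathbb{N}^{P\times M}$ ($v[(p,m)]$ = number of messages $m$ in $p$'s mailbox). A rule $q_1\xrightarrow{op}q_2$ is enabled at $(u,v)$ if $u[q_1]\ge1$ (and, for $op=p?m$, $v[(p,m)]\ge1$); firing it decrements $u[q_1]$, increments $u[q_2]$, and additionally: for $\nu q_3$ increments $u[q_3]$; for $p!m$ increments $v[(p,m)]$; for $p?m$ decrements $v[(p,m)]$; $nop$ has no further effect. $\Rightarrow^{*}$ is the reflexive transitive closure of the one-step relation. The associated BPP $\mathcal{B}=(V,\Delta)$ has symbols $V=Q\cup(P\times M\times\{in,out\})$ (writing $(p,m^{in})$, $(p,m^{out})$) and, for each rule $q_1\xrightarrow{op}q_2\in R$, a rule: $q_1\to q_2$ if $op=nop$; $q_1\to q_2\,q_3$ if $op=\nu q_3$; $q_1\to q_2\,(p,m^{in})$ if $op=p!m$; $q_1\to q_2\,(p,m^{out})$ if $op=p?m$. A place of $\mathcal{B}$ is $(u_{\mathcal{B}},v_{\mathcal{B}})$ with $u_{\mathcal{B}}\in\mathbb{N}^Q$, $v_{\mathcal{B}}\in\mathbb{N}^{P\times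 M\times\{in,out\}}$, i.e. a multiset over $V$; a BPP rule $X\to\alpha$ applies when the count of $X$ is at least $1$, removing one $X$ and adding $\alpha$; $\to^{\star}$ is its reflexive transitive closure. The place convert function maps a place $(u_{\mathcal{A}},v_{\mathcal{A}})$ of $\mathcal{A}$ to $(u_{\mathcal{B}},v_{\mathcal{B}})$ with $u_{\mathcal{B}}[q]=u_{\mathcal{A}}[q]$ for all $q\in Q$, $v_{\mathcal{B}}[(p,m^{in})]=v_{\mathcal{A}}[(p,m)]$ and $v_{\mathcal{B}}[(p,m^{out})]=0$ for all $p\in P,m\in M$. *)

theory Defs
  imports Main "HOL-Library.Multiset"
begin

datatype ('q, 'p, 'm) acs_op =
    Nop
  | New 'q        \<comment> \<open>\<open>\<nu> q\<close>\<close>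
  | Send 'p 'm    \<comment> \<open>\<open>p!m\<close>\<close>
  | Recv 'p 'm    \<comment> \<open>\<open>p?m\<close>\<close>

type_synonym ('q, 'p, 'm) acs_rule = "'q \<times> ('q, 'p, 'm) acs_op \<times> 'q"

record ('q, 'p, 'm) acs =
  states :: "'q set"
  procs :: "'p set"
  msgs :: "'m set"
  rules :: "('q, 'p, 'm) acs_rule set"

primrec op_over :: "'q set \<Rightarrow> 'p set \<Rightarrow> 'm set \<Rightarrow> ('q, 'p, 'm) acs_op \<Rightarrow> bool" where
  "op_over Q P M Nop \<longleftrightarrow> True"
| "op_over Q P M (New q) \<longleftrightarrow> q \<in> Q"
| "op_over Q P M (Send p m) \<longleftrightarrow> p \<in> P \<and> m \<in> M"
| "op_over Q P M (Recv p m) \<longleftrightarrow> p \<in> P \<and> m \<in> M"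

definition is_acs :: "('q, 'p, 'm) acs \<Rightarrow> bool" where
  "is_acs A \<longleftrightarrow>
     finite (states A) \<and> finite (procs A) \<and> finite (msgs A) \<and> finite (rules A) \<and>
     (\<forall>(q1, act, q2) \<in> rules A.
        q1 \<in> states A \<and> q2 \<in> states A \<and> op_over (states A) (procs A) (msgs A) act)"

text \<open>For a finite set \<open>X\<close>, a vector in \<open>\<nat>\<^sup>X\<close> is rendered as a multiset with support in \<open>X\<close>;
  its entry at \<open>x\<close> is \<^const>\<open>count\<close> at \<open>x\<close>.\<close>

type_synonym ('q, 'p, 'm) acs_place = "'q multiset \<times> ('p \<times> 'm) multiset"

definition acs_places :: "('q, 'p, 'm) acs \<Rightarrow> ('q, 'p, 'm) acs_place set" where
  "acs_places A = {(u, v). set_mset u \<subseteq> states A \<and> set_mset v \<subseteq> procs A \<times> msgs A}"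

fun acs_enabled :: "('q, 'p, 'm) acs_rule \<Rightarrow> ('q, 'p, 'm) acs_place \<Rightarrow> bool" where
  "acs_enabled (q1, act, q2) (u, v) \<longleftrightarrow>
     count u q1 \<ge> 1 \<and> (\<forall>p m. act = Recv p m \<longrightarrow> count v (p, m) \<ge> 1)"

fun acs_fire :: "('q, 'p, 'm) acs_rule \<Rightarrow> ('q, 'p, 'm) acs_place \<Rightarrow> ('q, 'p, 'm) acs_place" where
  "acs_fire (q1, Nop, q2) (u, v) = (u - {#q1#} + {#q2#}, v)"
| "acs_fire (q1, New q3, q2) (u, v) = (u - {#q1#} + {#q2#} + {#q3#}, v)"
| "acs_fire (q1, Send p m, q2) (u, v) = (u - {#q1#} + {#q2#}, v + {#(p, m)#})"
| "acs_fire (q1, Recv p m, q2) (u, v) = (u - {#q1#} + {#q2#}, v - {#(p, m)#})"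

definition acs_step :: "('q, 'p, 'm) acs \<Rightarrow> ('q, 'p, 'm) acs_place \<Rightarrow> ('q, 'p, 'm) acs_place \<Rightarrow> bool" where
  "acs_step A c c' \<longleftrightarrow> (\<exists>r \<in> rules A. acs_enabled r c \<and> c' = acs_fire r c)"

abbreviation acs_reach :: "('q, 'p, 'm) acs \<Rightarrow> ('q, 'p, 'm) acs_place \<Rightarrow> ('q, 'p, 'm) acs_place \<Rightarrow> bool" where
  "acs_reach A \<equiv> (acs_step A)\<^sup>*\<^sup>*"

record 's bpp =
  symbols :: "'s set"
  prods :: "('s \<times> 's multiset) set"

definition is_bpp :: "'s bpp \<Rightarrow> bool" where
  "is_bpp B \<longleftrightarrow> finite (symbols B) \<and> finite (prods B) \<and>
     (\<forall>(X, \<alpha>) \<in> prods B. X \<in> symbols B \<and> set_mset \<alpha> \<subseteq> symbols B)"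

definition bpp_places :: "'s bpp \<Rightarrow> 's multiset set" where
  "bpp_places B = {c. set_mset c \<subseteq> symbols B}"

definition bpp_step :: "'s bpp \<Rightarrow> 's multiset \<Rightarrow> 's multiset \<Rightarrow> bool" where
  "bpp_step B c c' \<longleftrightarrow> (\<exists>(X, \<alpha>) \<in> prods B. count c X \<ge> 1 \<and> c' = c - {#X#} + \<alpha>)"

abbreviation bpp_reach :: "'s bpp \<Rightarrow> 's multiset \<Rightarrow> 's multiset \<Rightarrow> bool" where
  "bpp_reach B \<equiv> (bpp_step B)\<^sup>*\<^sup>*"

datatype dir = In | Out

text \<open>A place \<open>(u, v)\<close> of the associated BPP is the multiset \<open>c\<close> over these symbols with
  \<open>u[q] = count c (St q)\<close> and \<open>v[(p, m\<^sup>d)] = count c (Msg p m d)\<close>.\<close>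

datatype ('q, 'p, 'm) symb = St 'q | Msg 'p 'm dir

fun assoc_prod :: "('q, 'p, 'm) acs_rule \<Rightarrow> ('q, 'p, 'm) symb \<times> ('q, 'p, 'm) symb multiset" where
  "assoc_prod (q1, Nop, q2) = (St q1, {#St q2#})"
| "assoc_prod (q1, New q3, q2) = (St q1, {#St q2, St q3#})"
| "assoc_prod (q1, Send p m, q2) = (St q1, {#St q2, Msg p m In#})"
| "assoc_prod (q1, Recv p m, q2) = (St q1, {#St q2, Msg p m Out#})"

definition assoc_bpp :: "('q, 'p, 'm) acs \<Rightarrow> ('q, 'p, 'm) symb bpp" where
  "assoc_bpp A =
     \<lparr>symbols = St ` states A \<union> {Msg p m d | p m d. p \<in> procs A \<and> m \<in> msgs A \<and> d \<in> {In, Out}},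
      prods = assoc_prod ` rules A\<rparr>"

fun place_convert :: "('q, 'p, 'm) acs_place \<Rightarrow> ('q, 'p, 'm) symb multiset" where
  "place_convert (u, v) = image_mset St u + image_mset (\<lambda>(p, m). Msg p m In) v"

lemma count_image_mset_not_in_image:
  "(\<And>x. f x \<noteq> y) \<Longrightarrow> count (image_mset f X) y = 0"
  by (induction X) auto

lemma count_place_convert:
  shows "count (place_convert (u, v)) (St q) = count u q"
    and "count (place_convert (u, v)) (Msg p m In) = count v (p, m)"
    and "count (place_convert (u, v)) (Msg p m Out) = 0"
proof -
  have St: "count (image_mset St u) (St q) = count u q"
    by (induction u) auto
  have Msg: "count (image_mset (\<lambda>(p, m). Msg p m In) v) (Msg p m In) = count v (p, m)"
    by (induction v) auto
  show "count (place_convert (u, v)) (St q) = count u q"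
    using St by (auto simp: count_image_mset_not_in_image split: prod.splits)
  show "count (place_convert (u, v)) (Msg p m In) = count v (p, m)"
    using Msg by (auto simp: count_image_mset_not_in_image)
  show "count (place_convert (u, v)) (Msg p m Out) = 0"
    by (auto simp: count_image_mset_not_in_image split: prod.splits)
qed

lemma place_convert_in_bpp_places:
  "c \<in> acs_places A \<Longrightarrow> place_convert c \<in> bpp_places (assoc_bpp A)"
  by (cases c) (auto simp: acs_places_def bpp_places_def assoc_bpp_def)

lemma is_bpp_assoc_bpp:
  assumes "is_acs A"
  shows "is_bpp (assoc_bpp A)"
proof -
  have fin: "finite {Msg p m d :: ('a, 'b, 'c) symb | p m d. p \<in> procs A \<and> m \<in> msgs A \<and> d \<in> {In, Out}}"
  proof -
    have "{Msg p m d :: ('a, 'b, 'c) symb | p m d. p \<in> procs A \<and> m \<in> msgs A \<and> d \<in> {In, Out}}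
          = (\<lambda>(p, m, d). Msg p m d) ` (procs A \<times> msgs A \<times> {In, Out})"
      by force
    then show ?thesis using assms by (simp add: is_acs_def)
  qed
  have "X \<in> symbols (assoc_bpp A) \<and> set_mset \<alpha> \<subseteq> symbols (assoc_bpp A)"
    if "(X, \<alpha>) \<in> prods (assoc_bpp A)" for X \<alpha>
  proof -
    from that obtain q1 act q2 where r: "(q1, act, q2) \<in> rules A" "(X, \<alpha>) = assoc_prod (q1, act, q2)"
      by (auto simp: assoc_bpp_def)
    then have "q1 \<in> states A" "q2 \<in> states A" "op_over (states A) (procs A) (msgs A) act"
      using assms by (auto simp: is_acs_def)
    then show ?thesis using r(2) by (cases act) (auto simp: assoc_bpp_def)
  qed
  moreover have "finite (symbols (assoc_bpp A))" "finite (prods (assoc_bpp A))"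
    using fin assms by (simp_all add: is_acs_def assoc_bpp_def)
  ultimately show ?thesis
    unfolding is_bpp_def by blast
qed

end

theory Submission
  imports Defs
begin

text \<open>Replaying an ACS run in the BPP never gets stuck, since BPP rules only consume control states:
  receiving a message \<open>(p, m)\<close> adds a symbol \<open>(p, m\<^sup>o\<^sup>u\<^sup>t)\<close> instead of removing a \<open>(p, m\<^sup>i\<^sup>n)\<close>.
  So the number of \<open>in\<close> symbols minus the number of \<open>out\<close> symbols tracks the mailbox.\<close>

text \<open>The message equation is additive because subtraction on \<open>nat\<close> truncates.
  The \<open>Out\<close> counts stay free: in a replay from \<open>place_convert\<close> they count
  the messages received so far, which the ACS place does not remember.\<close>

fun bpp_represents :: "('q, 'p, 'm) symb multiset \<Rightarrow> ('q, 'p, 'm) acs_place \<Rightarrow> bool" where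
  "bpp_represents c (u, v) \<longleftrightarrow>
     (\<forall>q. count c (St q) = count u q) \<and>
     (\<forall>p m. count c (Msg p m In) = count v (p, m) + count c (Msg p m Out))"

lemma bpp_represents_place_convert: "bpp_represents (place_convert a) a"
  by (cases a) (simp add: count_place_convert del: place_convert.simps)

text \<open>On \<open>Recv\<close> the mailbox entry drops by one while \<open>Out\<close> rises by
  one, so their sum is unchanged; enabledness makes this subtraction on \<open>nat\<close> exact. On
  \<open>Send\<close> both sides rise by one.\<close>

lemma bpp_represents_fire:
  assumes "acs_enabled r a" and "bpp_represents c a" and "assoc_prod r = (X, \<alpha>)"
  shows "count c X \<ge> 1 \<and> bpp_represents (c - {#X#} + \<alpha>) (acs_fire r a)"
proof -
  obtain q1 act q2 where r: "r = (q1, act, q2)" by (cases r)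
  obtain u v where a: "a = (u, v)" by (cases a)
  have "St q1 \<in># c"
    using assms(1,2) unfolding r a by (simp flip: count_greater_zero_iff)
  then show ?thesis
    using assms unfolding r a by (cases act) auto
qed

lemma bpp_represents_step:
  assumes "acs_step A a a'" and "bpp_represents c a"
  shows "\<exists>c'. bpp_step (assoc_bpp A) c c' \<and> bpp_represents c' a'"
proof -
  obtain r where r: "r \<in> rules A" "acs_enabled r a" "a' = acs_fire r a"
    using assms(1) by (auto simp: acs_step_def)
  obtain X \<alpha> where X: "assoc_prod r = (X, \<alpha>)" by (cases "assoc_prod r")
  then have "(X, \<alpha>) \<in> prods (assoc_bpp A)"
    using r(1) by (force simp: assoc_bpp_def)
  then show ?thesis
    using bpp_represents_fire[OF r(2) assms(2) X] r(3) unfolding bpp_step_def by blast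
qed

lemma bpp_represents_reach:
  assumes "acs_reach A a a'" and "bpp_represents c a"
  shows "\<exists>c'. bpp_reach (assoc_bpp A) c c' \<and> bpp_represents c' a'"
  using assms by induction (blast dest: bpp_represents_step intro: rtranclp.rtrancl_into_rtrancl)+

text \<open>Supports are tracked separately because \<open>bpp_represents\<close> does not bound
  them: for a pair \<open>(p, m)\<close> outside the system with no pending message, any equal
  nonzero \<open>In\<close> and \<open>Out\<close> counts satisfy it.\<close>

lemma bpp_places_step:
  assumes "is_bpp B" and "bpp_step B c c'" and "c \<in> bpp_places B"
  shows "c' \<in> bpp_places B"
  using assms by (fastforce simp: is_bpp_def bpp_step_def bpp_places_def dest: in_diffD)

lemma bpp_places_reach:
  assumes "is_bpp B" and "bpp_reach B c c'" and "c \<in> bpp_places B"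
  shows "c' \<in> bpp_places B"
  using assms(2,3) by induction (auto intro: bpp_places_step[OF assms(1)])

theorem theorem5:
  fixes A :: "('q, 'p, 'm) acs"
    and cA0 :: "('q, 'p, 'm) acs_place"
    and uA :: "'q multiset" and vA :: "('p \<times> 'm) multiset"
    and k :: "'q \<Rightarrow> nat" and h :: "'p \<Rightarrow> 'm \<Rightarrow> nat"
  assumes "is_acs A"
    and "cA0 \<in> acs_places A"
    and "(uA, vA) \<in> acs_places A"
    and "acs_reach A cA0 (uA, vA)"
    and "\<forall>q \<in> states A. count uA q = k q"
    and "\<forall>p \<in> procs A. \<forall>m \<in> msgs A. count vA (p, m) = h p m"
  shows "\<exists>cB \<in> bpp_places (assoc_bpp A). \<exists>r s :: 'p \<Rightarrow> 'm \<Rightarrow> nat.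
           (\<forall>q \<in> states A. count cB (St q) = k q) \<and>
           (\<forall>p \<in> procs A. \<forall>m \<in> msgs A.
              count cB (Msg p m In) = r p m \<and>
              count cB (Msg p m Out) = s p m \<and>
              int (r p m) - int (s p m) = int (h p m)) \<and>
           bpp_reach (assoc_bpp A) (place_convert cA0) cB"
proof -
  obtain cB where cB: "bpp_reach (assoc_bpp A) (place_convert cA0) cB" "bpp_represents cB (uA, vA)"
    using bpp_represents_reach[OF assms(4) bpp_represents_place_convert] by blast
  have "cB \<in> bpp_places (assoc_bpp A)"
    using bpp_places_reach[OF is_bpp_assoc_bpp cB(1) place_convert_in_bpp_places] assms(1,2) by blast
  moreover have "\<forall>q \<in> states A. count cB (St q) = k q"
    using cB(2) assms(5) by simp
  \<comment> \<open>The additive invariant becomes a difference over \<open>int\<close>, where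
    subtraction is exact.\<close>
  moreover have "\<forall>p \<in> procs A. \<forall>m \<in> msgs A.
      int (count cB (Msg p m In)) - int (count cB (Msg p m Out)) = int (h p m)"
    using cB(2) assms(6) by simp
  ultimately show ?thesis
    using cB(1)
    by (intro bexI[of _ cB] exI[of _ "\<lambda>p m. count cB (Msg p m In)"]
          exI[of _ "\<lambda>p m. count cB (Msg p m Out)"]) auto
qed

end
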